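(* Let $H$ be a finite graph, $\ell\ge 0$ and $k\ge 1$ integers. If every graph that is both $H$-free and $K_3$-free is $k$-colourable, then every graph that is both $(H+\ell P_1)$-free and $K_3$-free is $(k+\ell)$-colourable.
   Context: All graphs are finite and simple. A graph is $F$-free if it has no induced subgraph isomorphic to $F$. $H+\ell P_1$ denotes the disjoint union of $H$ with $\ell$ isolated vertices; $K_3$ is the triangle. *)

theory Defs
  imports "HOL-Library.Ramsey"
begin

text \<open>
  Graphs carry an explicit vertex set; an edge is a two-element set of vertices.
  The term \<open>nsets A 2\<close>, also written \<open>[A]\<^bsup>2\<^esup>\<close>, is the library's set of all two-element
  subsets of \<open>A\<close>. The graph without vertices is admitted.
\<close>

datatype 'a graph = Graph (verts: "'a set") (edges: "'a set set")

definition simple_graph :: "'a graph \<Rightarrow> bool" where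
  "simple_graph G \<longleftrightarrow> finite (verts G) \<and> edges G \<subseteq> nsets (verts G) 2"

definition graph_iso :: "'a graph \<Rightarrow> 'b graph \<Rightarrow> bool" where
  "graph_iso F G \<longleftrightarrow>
     (\<exists>f. bij_betw f (verts F) (verts G) \<and>
          (\<forall>x\<in>verts F. \<forall>y\<in>verts F. {x, y} \<in> edges F \<longleftrightarrow> {f x, f y} \<in> edges G))"

definition induced_subgraph :: "'a graph \<Rightarrow> 'a set \<Rightarrow> 'a graph" where
  "induced_subgraph G S = Graph S {e \<in> edges G. e \<subseteq> S}"

definition free_of :: "'f graph \<Rightarrow> 'a graph \<Rightarrow> bool" where
  "free_of F G \<longleftrightarrow> \<not> (\<exists>S\<subseteq>verts G. graph_iso F (induced_subgraph G S))"

definition complete_graph :: "nat \<Rightarrow> nat graph" where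
  "complete_graph n = Graph {..<n} (nsets {..<n} 2)"

definition edgeless_graph :: "nat \<Rightarrow> nat graph" where
  "edgeless_graph n = Graph {..<n} {}"

definition disjoint_union :: "'a graph \<Rightarrow> 'b graph \<Rightarrow> ('a + 'b) graph" where
  "disjoint_union F G =
     Graph (verts F <+> verts G) (((`) Inl ` edges F) \<union> ((`) Inr ` edges G))"

definition colourable :: "nat \<Rightarrow> 'a graph \<Rightarrow> bool" where
  "colourable k G \<longleftrightarrow>
     (\<exists>c :: 'a \<Rightarrow> nat. (\<forall>v\<in>verts G. c v < k) \<and>
        (\<forall>x y. {x, y} \<in> edges G \<longrightarrow> c x \<noteq> c y))"

end

(* For the inductive step, fix a vertex v of G. Its neighbourhood is independent because G
   is triangle-free, so it can take a single new colour. The set A of vertices that are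
   neither v nor adjacent to v induces an (H + l P_1)-free graph, since v would serve as one
   more isolated vertex. Colour A by induction; v itself reuses a colour of A, as it has no
   neighbour there. This last choice needs at least one old colour, hence k >= 1. *)

theory Submission
  imports Defs
begin

section \<open>Vertices and edges of the graph constructions\<close>

lemma verts_induced_subgraph [simp]: "verts (induced_subgraph G S) = S"
  by (simp add: induced_subgraph_def)

lemma edges_induced_subgraph [simp]: "edges (induced_subgraph G S) = {e \<in> edges G. e \<subseteq> S}"
  by (simp add: induced_subgraph_def)

lemma verts_disjoint_union [simp]: "verts (disjoint_union F G) = verts F <+> verts G"
  by (simp add: disjoint_union_def)

text \<open>Each edge is an image under \<open>Inl\<close> or under \<open>Inr\<close>, so
  injectivity of the constructors settles pairs from one side, and mixed pairs lie in neither image.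
  Stated for explicit pairs, this lets a case split on the two endpoints decide adjacency.\<close>

lemma edges_disjoint_union [simp]:
  fixes F :: "'a graph" and G :: "'b graph"
  shows "{Inl x, Inl y} \<in> edges (disjoint_union F G) \<longleftrightarrow> {x, y} \<in> edges F"
    and "{Inr u, Inr v} \<in> edges (disjoint_union F G) \<longleftrightarrow> {u, v} \<in> edges G"
    and "{Inl x, Inr v} \<notin> edges (disjoint_union F G)"
    and "{Inr v, Inl x} \<notin> edges (disjoint_union F G)"
proof -
  have "{Inl x, Inl y :: 'a + 'b} = Inl ` e \<longleftrightarrow> {x, y} = e" for e :: "'a set"
    using inj_image_eq_iff[of "Inl :: 'a \<Rightarrow> 'a + 'b" "{x, y}" e] by simp
  moreover have "{Inr u, Inr v :: 'a + 'b} = Inr ` e \<longleftrightarrow> {u, v} = e" for e :: "'b set"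
    using inj_image_eq_iff[of "Inr :: 'b \<Rightarrow> 'a + 'b" "{u, v}" e] by simp
  moreover have "{Inl x, Inl y} \<noteq> Inr ` e" for e :: "'b set" by blast
  moreover have "{Inr u, Inr v} \<noteq> Inl ` e" for e :: "'a set" by blast
  ultimately show "{Inl x, Inl y} \<in> edges (disjoint_union F G) \<longleftrightarrow> {x, y} \<in> edges F"
    "{Inr u, Inr v} \<in> edges (disjoint_union F G) \<longleftrightarrow> {u, v} \<in> edges G"
    by (simp_all add: disjoint_union_def image_iff)
  show "{Inl x, Inr v} \<notin> edges (disjoint_union F G)"
    "{Inr v, Inl x} \<notin> edges (disjoint_union F G)"
    by (auto simp: disjoint_union_def)
qed

lemma verts_edgeless_graph [simp]: "verts (edgeless_graph n) = {..<n}"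
  and edges_edgeless_graph [simp]: "edges (edgeless_graph n) = {}"
  by (simp_all add: edgeless_graph_def)

lemma simple_graph_edgeD:
  assumes "simple_graph G" "{x, y} \<in> edges G"
  shows "x \<in> verts G" "y \<in> verts G" "x \<noteq> y"
  using assms by (auto simp: simple_graph_def nsets_def)

lemma simple_graph_induced_subgraph:
  assumes "simple_graph G" "S \<subseteq> verts G"
  shows "simple_graph (induced_subgraph G S)"
  using assms finite_subset by (auto simp: simple_graph_def nsets_def)

section \<open>Isomorphism, and copies of a graph along an injection\<close>

lemma graph_iso_sym:
  assumes "graph_iso F G"
  shows "graph_iso G F"
proof -
  obtain f where f: "bij_betw f (verts F) (verts G)"
    and e: "\<And>x y. x \<in> verts F \<Longrightarrow> y \<in> verts F \<Longrightarrow> {x, y} \<in> edges F \<longleftrightarrow> {f x, f y} \<in> edges G"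
    using assms by (auto simp: graph_iso_def)
  let ?g = "inv_into (verts F) f"
  have "bij_betw ?g (verts G) (verts F)"
    by (rule bij_betw_inv_into[OF f])
  moreover have "{x, y} \<in> edges G \<longleftrightarrow> {?g x, ?g y} \<in> edges F"
    if "x \<in> verts G" "y \<in> verts G" for x y
    using that e[of "?g x" "?g y"] bij_betw_inv_into_right[OF f] calculation
    by (simp add: bij_betw_apply)
  ultimately show ?thesis
    by (auto simp: graph_iso_def)
qed

lemma graph_iso_trans:
  assumes "graph_iso F G" "graph_iso G K"
  shows "graph_iso F K"
proof -
  obtain f where f: "bij_betw f (verts F) (verts G)"
    and ef: "\<And>x y. x \<in> verts F \<Longrightarrow> y \<in> verts F \<Longrightarrow> {x, y} \<in> edges F \<longleftrightarrow> {f x, f y} \<in> edges G"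
    using assms(1) by (auto simp: graph_iso_def)
  obtain g where g: "bij_betw g (verts G) (verts K)"
    and eg: "\<And>x y. x \<in> verts G \<Longrightarrow> y \<in> verts G \<Longrightarrow> {x, y} \<in> edges G \<longleftrightarrow> {g x, g y} \<in> edges K"
    using assms(2) by (auto simp: graph_iso_def)
  have "{x, y} \<in> edges F \<longleftrightarrow> {(g \<circ> f) x, (g \<circ> f) y} \<in> edges K"
    if "x \<in> verts F" "y \<in> verts F" for x y
    using that ef eg bij_betw_apply[OF f] by simp
  with bij_betw_trans[OF f g] show ?thesis
    unfolding graph_iso_def by blast
qed

text \<open>Serves to move a graph to another vertex type: the theorem's assumption concerns graphs
  on \<open>nat\<close>, its conclusion graphs on an arbitrary type.\<close>

lemma graph_iso_image:
  assumes "inj_on f (verts G)" "simple_graph G"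
  shows "graph_iso G (Graph (f ` verts G) ((`) f ` edges G))"
proof -
  have "{x, y} \<in> edges G \<longleftrightarrow> {f x, f y} \<in> (`) f ` edges G"
    if "x \<in> verts G" "y \<in> verts G" for x y
  proof
    assume "{f x, f y} \<in> (`) f ` edges G"
    then obtain e where e: "e \<in> edges G" "f ` {x, y} = f ` e" by auto
    \<comment> \<open>Since \<open>f\<close> is injective on \<open>verts G\<close> only, equal
      images force equal sets only for subsets of \<open>verts G\<close>.\<close>
    moreover have "e \<subseteq> verts G"
      using e(1) assms(2) by (auto simp: simple_graph_def nsets_def)
    ultimately have "{x, y} = e"
      using that by (metis assms(1) empty_subsetI inj_on_image_eq_iff insert_subset)
    with e(1) show "{x, y} \<in> edges G" by simp
  qed (auto simp: image_iff intro!: bexI[of _ "{x, y}"])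
  with assms(1) show ?thesis
    unfolding graph_iso_def by (intro exI[of _ f]) (auto simp: inj_on_imp_bij_betw)
qed

lemma simple_graph_image:
  assumes "inj_on f (verts G)" "simple_graph G"
  shows "simple_graph (Graph (f ` verts G) ((`) f ` edges G))"
proof -
  have "f ` e \<in> nsets (f ` verts G) 2" if "e \<in> edges G" for e
  proof -
    have "e \<subseteq> verts G" "finite e" "card e = 2"
      using that assms(2) by (auto simp: simple_graph_def nsets_def)
    then show ?thesis
      using card_image[OF inj_on_subset[OF assms(1)]] by (auto simp: nsets_def)
  qed
  with assms(2) show ?thesis by (auto simp: simple_graph_def)
qed

section \<open>Freeness and colourability under induced subgraphs and isomorphism\<close>

lemma free_of_induced_subgraph:
  assumes "free_of F G" "S \<subseteq> verts G"
  shows "free_of F (induced_subgraph G S)"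
proof -
  have "induced_subgraph (induced_subgraph G S) T = induced_subgraph G T" if "T \<subseteq> S" for T
    using that by (auto simp: induced_subgraph_def)
  with assms show ?thesis
    unfolding free_of_def by (metis subset_trans verts_induced_subgraph)
qed

lemma free_of_iso_left:
  assumes "graph_iso F F'" "free_of F' G"
  shows "free_of F G"
  using assms graph_iso_sym graph_iso_trans unfolding free_of_def by blast

text \<open>The inverse isomorphism carries a copy of \<open>F\<close> in \<open>G'\<close> to a
  copy on the image set in \<open>G\<close>.\<close>

lemma free_of_iso_right:
  assumes "graph_iso G G'" "free_of F G"
  shows "free_of F G'"
  unfolding free_of_def
proof
  assume "\<exists>S\<subseteq>verts G'. graph_iso F (induced_subgraph G' S)"
  then obtain S where S: "S \<subseteq> verts G'" and iso: "graph_iso F (induced_subgraph G' S)"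
    by blast
  obtain f where f: "bij_betw f (verts G') (verts G)"
    and e: "\<And>x y. x \<in> verts G' \<Longrightarrow> y \<in> verts G' \<Longrightarrow> {x, y} \<in> edges G' \<longleftrightarrow> {f x, f y} \<in> edges G"
    using graph_iso_sym[OF assms(1)] by (auto simp: graph_iso_def)
  have "bij_betw f S (f ` S)"
    using f S by (meson bij_betw_def bij_betw_subset)
  then have "graph_iso (induced_subgraph G' S) (induced_subgraph G (f ` S))"
    using S e unfolding graph_iso_def by (intro exI[of _ f]) auto
  moreover have "f ` S \<subseteq> verts G"
    using f S by (auto simp: bij_betw_def)
  ultimately show False
    using iso assms(2) graph_iso_trans unfolding free_of_def by blast
qed

lemma colourable_iso:
  assumes "graph_iso G G'" "simple_graph G" "colourable k G'"
  shows "colourable k G"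
proof -
  obtain f where f: "bij_betw f (verts G) (verts G')"
    and e: "\<And>x y. x \<in> verts G \<Longrightarrow> y \<in> verts G \<Longrightarrow> {x, y} \<in> edges G \<longleftrightarrow> {f x, f y} \<in> edges G'"
    using assms(1) by (auto simp: graph_iso_def)
  obtain c where c: "\<And>v. v \<in> verts G' \<Longrightarrow> c v < k" "\<And>x y. {x, y} \<in> edges G' \<Longrightarrow> c x \<noteq> c y"
    using assms(3) by (auto simp: colourable_def)
  \<comment> \<open>\<open>colourable\<close> ranges over all pairs \<open>x\<close>,
    \<open>y\<close>, while \<open>e\<close> covers vertices only; simplicity of \<open>G\<close>
    puts the ends of an edge among the vertices.\<close>
  have "(c \<circ> f) x \<noteq> (c \<circ> f) y" if "{x, y} \<in> edges G" for x y
    using that e c(2) simple_graph_edgeD[OF assms(2) that] by simp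
  moreover have "(c \<circ> f) v < k" if "v \<in> verts G" for v
    using that c(1) bij_betw_apply[OF f] by simp
  ultimately show ?thesis
    unfolding colourable_def by blast
qed

section \<open>Adding isolated vertices to a copy of H\<close>

lemma graph_iso_disjoint_union_edgeless_0: "graph_iso H (disjoint_union H (edgeless_graph 0))"
  unfolding graph_iso_def by (intro exI[of _ Inl]) (auto simp: bij_betw_def)

text \<open>The union for \<open>Suc l\<close> has exactly one more vertex, \<open>Inr l\<close>,
  and no more edges. Sending \<open>Inr l\<close> to \<open>v\<close> therefore extends the given
  isomorphism.\<close>

lemma graph_iso_insert_isolated:
  assumes G: "simple_graph G"
    and iso: "graph_iso (disjoint_union H (edgeless_graph l)) (induced_subgraph G S)"
    and v: "v \<notin> S" "\<And>x. x \<in> S \<Longrightarrow> {v, x} \<notin> edges G"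
  shows "graph_iso (disjoint_union H (edgeless_graph (Suc l))) (induced_subgraph G (insert v S))"
proof -
  let ?D = "\<lambda>n. disjoint_union H (edgeless_graph n)"
  obtain f where f: "bij_betw f (verts H <+> {..<l}) S"
    and e: "\<And>x y. x \<in> verts H <+> {..<l} \<Longrightarrow> y \<in> verts H <+> {..<l} \<Longrightarrow>
      {x, y} \<in> edges (?D l) \<longleftrightarrow> {f x, f y} \<in> edges G \<and> {f x, f y} \<subseteq> S"
    using iso by (auto simp: graph_iso_def)
  let ?g = "f(Inr l := v)"
  have D: "verts (?D (Suc l)) = insert (Inr l) (verts H <+> {..<l})"
    by (auto simp: less_Suc_eq)
  have new: "Inr l \<notin> verts H <+> {..<l}" by auto
  have fS: "f x \<in> S" if "x \<in> verts H <+> {..<l}" for x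
    using that by (rule bij_betw_apply[OF f])
  have "bij_betw ?g (verts H <+> {..<l}) S"
    using f by (rule bij_betw_cong[THEN iffD1, rotated]) (use new in auto)
  then have "bij_betw ?g (verts (?D (Suc l))) (insert v S)"
    unfolding D using notIn_Un_bij_betw[of "Inr l" _ ?g S] new v(1) by simp
  moreover have "{x, y} \<in> edges (?D (Suc l)) \<longleftrightarrow> {?g x, ?g y} \<in> edges (induced_subgraph G (insert v S))"
    if xy: "x \<in> verts (?D (Suc l))" "y \<in> verts (?D (Suc l))" for x y
  proof -
    have iso_l: "{Inr l, z} \<notin> edges (?D (Suc l))" for z
      by (cases z) auto
    have same: "{x, y} \<in> edges (?D (Suc l)) \<longleftrightarrow> {x, y} \<in> edges (?D l)"
      by (cases x; cases y) auto
    \<comment> \<open>\<open>graph_iso\<close> also compares pairs with equal entries, so the case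
      in which \<open>x\<close> and \<open>y\<close> are both \<open>Inr l\<close> needs the absence
      of loops.\<close>
    have vv: "{v, v} \<notin> edges G"
      using simple_graph_edgeD(3)[OF G] by blast
    consider "x = Inr l" | "y = Inr l" "x \<noteq> Inr l"
      | "x \<in> verts H <+> {..<l}" "y \<in> verts H <+> {..<l}"
      using xy unfolding D by blast
    then show ?thesis
    proof cases
      case 1
      then have "{?g x, ?g y} \<notin> edges G"
        using xy(2) v(2) vv fS unfolding D by auto
      with 1 iso_l show ?thesis by simp
    next
      case 2
      then have "{?g y, ?g x} \<notin> edges G"
        using xy(1) v(2) fS unfolding D by auto
      with 2 iso_l[of x] show ?thesis by (simp add: insert_commute)
    next
      case 3
      then have "?g x = f x" "?g y = f y"
        using new by auto
      with 3 e[OF 3] fS same show ?thesis by auto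
    qed
  qed
  ultimately show ?thesis
    unfolding graph_iso_def by (intro exI[of _ ?g]) (simp del: verts_disjoint_union)
qed

section \<open>Colouring a triangle-free graph around one vertex\<close>

lemma triangle_freeD:
  assumes G: "simple_graph G" and free: "free_of (complete_graph 3) G"
    and xy: "{v, x} \<in> edges G" "{v, y} \<in> edges G"
  shows "{x, y} \<notin> edges G"
proof
  assume e: "{x, y} \<in> edges G"
  note distinct = simple_graph_edgeD(3)[OF G xy(1)] simple_graph_edgeD(3)[OF G xy(2)]
    simple_graph_edgeD(3)[OF G e]
  have noloop: "{z} \<notin> edges G" for z
    using simple_graph_edgeD(3)[OF G, of z z] by auto
  \<comment> \<open>Enumerates the would-be triangle by the vertices 0, 1, 2 of
    \<open>complete_graph 3\<close>; \<open>noloop\<close> handles the pairs of equal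
    vertices.\<close>
  let ?f = "\<lambda>i::nat. if i = 0 then v else if i = 1 then x else y"
  have three: "{..<3::nat} = {0, 1, 2}" by auto
  have "{i, j} \<in> nsets {..<3} 2 \<longleftrightarrow> i \<noteq> j" if "i < 3" "j < 3" for i j :: nat
    using that by (auto simp: nsets_def)
  moreover have "bij_betw ?f {..<3} {v, x, y}"
    unfolding three bij_betw_def using distinct by auto
  ultimately have "graph_iso (complete_graph 3) (induced_subgraph G {v, x, y})"
    unfolding graph_iso_def complete_graph_def
    using xy e noloop
    by (intro exI[of _ ?f]) (auto simp: three insert_commute)
  moreover have "{v, x, y} \<subseteq> verts G"
    using simple_graph_edgeD[OF G xy(1)] simple_graph_edgeD[OF G xy(2)] by simp
  ultimately show False
    using free unfolding free_of_def by blast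
qed

lemma colourable_Suc_nonneighbours:
  assumes G: "simple_graph G" and free: "free_of (complete_graph 3) G" and "m \<ge> 1"
    and col: "colourable m (induced_subgraph G {x \<in> verts G. x \<noteq> v \<and> {v, x} \<notin> edges G})"
  shows "colourable (Suc m) G"
proof -
  define A where "A = {x \<in> verts G. x \<noteq> v \<and> {v, x} \<notin> edges G}"
  obtain c where c: "\<And>x. x \<in> A \<Longrightarrow> c x < m"
    "\<And>x y. {x, y} \<in> edges G \<Longrightarrow> x \<in> A \<Longrightarrow> y \<in> A \<Longrightarrow> c x \<noteq> c y"
    using col unfolding A_def[symmetric] by (auto simp: colourable_def)
  \<comment> \<open>The colour \<open>m\<close> is the new one, for the neighbours of
    \<open>v\<close>. The vertex \<open>v\<close> gets the old colour 0, which differs from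
    \<open>m\<close> because \<open>m\<close> is at least 1.\<close>
  define d where "d x = (if x = v then 0 else if {v, x} \<in> edges G then m else c x)" for x
  have "d x < Suc m" if "x \<in> verts G" for x
    using that c(1) by (auto simp: d_def A_def less_Suc_eq)
  moreover have "d x \<noteq> d y" if e: "{x, y} \<in> edges G" for x y
  proof -
    note xy = simple_graph_edgeD[OF G e]
    \<comment> \<open>The colour \<open>m\<close> never occurs at both ends of an edge.\<close>
    have "\<not> ({v, x} \<in> edges G \<and> {v, y} \<in> edges G)"
      using triangle_freeD[OF G free] e by blast
    \<comment> \<open>An edge at \<open>v\<close> has its other end among the neighbours, so the 0
      at \<open>v\<close> only ever meets \<open>m\<close>; it cannot clash with a 0 used by
      \<open>c\<close>.\<close>
    moreover have "{v, x} \<notin> edges G \<Longrightarrow> y \<noteq> v" "{v, y} \<notin> edges G \<Longrightarrow> x \<noteq> v"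
      using e by (auto simp: insert_commute)
    ultimately show ?thesis
      using xy e c(1)[of x] c(1)[of y] c(2)[of x y] \<open>m \<ge> 1\<close>
      by (auto simp: d_def A_def)
  qed
  ultimately show ?thesis
    unfolding colourable_def by blast
qed

section \<open>Induction on the number of isolated vertices\<close>

theorem theorem4:
  fixes H :: "'h graph" and l k :: nat
  assumes "simple_graph H"
    and "k \<ge> 1"
    and "\<forall>G :: nat graph. simple_graph G \<and> free_of H G \<and> free_of (complete_graph 3) G
           \<longrightarrow> colourable k G"
  shows "\<forall>G :: 'a graph. simple_graph G \<and> free_of (disjoint_union H (edgeless_graph l)) G
           \<and> free_of (complete_graph 3) G \<longrightarrow> colourable (k + l) G"
proof (induction l)
  case 0
  show ?case
  proof (intro allI impI; elim conjE)
    fix G :: "'a graph"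
    assume G: "simple_graph G" and K: "free_of (complete_graph 3) G"
      and "free_of (disjoint_union H (edgeless_graph 0)) G"
    \<comment> \<open>\<open>H\<close> and its union with the graph on no vertices have different
      vertex types, so an isomorphism takes the place of an equality.\<close>
    then have H: "free_of H G"
      using free_of_iso_left graph_iso_disjoint_union_edgeless_0 by blast
    \<comment> \<open>A finite graph has an isomorphic copy on natural numbers. The copy is simple
      and inherits both freeness conditions, so it is \<open>k\<close>-colourable, and the colouring
      is pulled back to \<open>G\<close>.\<close>
    obtain f :: "'a \<Rightarrow> nat" where f: "inj_on f (verts G)"
      using G finite_imp_inj_to_nat_seg by (metis simple_graph_def)
    show "colourable (k + 0) G"
      using assms(3) colourable_iso[OF graph_iso_image[OF f G] G] simple_graph_image[OF f G]
        free_of_iso_right[OF graph_iso_image[OF f G]] H K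
      by (metis add_0_right)
  qed
next
  case (Suc l)
  show ?case
  proof (intro allI impI; elim conjE)
    fix G :: "'a graph"
    assume G: "simple_graph G" and K: "free_of (complete_graph 3) G"
      and H: "free_of (disjoint_union H (edgeless_graph (Suc l))) G"
    show "colourable (k + Suc l) G"
    \<comment> \<open>With no vertex there is no \<open>v\<close> to choose; but then there are no
      edges either, and any function is a colouring.\<close>
    proof (cases "verts G = {}")
      case True
      then show ?thesis
        using simple_graph_edgeD(1)[OF G] by (auto simp: colourable_def)
    next
      case False
      then obtain v where v: "v \<in> verts G" by blast
      let ?A = "{x \<in> verts G. x \<noteq> v \<and> {v, x} \<notin> edges G}"
      have "free_of (disjoint_union H (edgeless_graph l)) (induced_subgraph G ?A)"
        unfolding free_of_def
      proof
        assume "\<exists>S\<subseteq>verts (induced_subgraph G ?A). graph_iso (disjoint_union H (edgeless_graph l))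
          (induced_subgraph (induced_subgraph G ?A) S)"
        then obtain S where S: "S \<subseteq> ?A" and "graph_iso (disjoint_union H (edgeless_graph l))
          (induced_subgraph (induced_subgraph G ?A) S)"
          by auto
        moreover have "induced_subgraph (induced_subgraph G ?A) S = induced_subgraph G S"
          using S by (auto simp: induced_subgraph_def)
        \<comment> \<open>By the choice of \<open>?A\<close>, the set \<open>S\<close> contains
          neither \<open>v\<close> nor a neighbour of \<open>v\<close>.\<close>
        ultimately have "graph_iso (disjoint_union H (edgeless_graph (Suc l)))
          (induced_subgraph G (insert v S))"
          using S by (intro graph_iso_insert_isolated[OF G]) auto
        moreover have "insert v S \<subseteq> verts G"
          using S v by auto
        ultimately show False
          using H unfolding free_of_def by blast
      qed
      moreover have "?A \<subseteq> verts G" by blast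
      ultimately have "colourable (k + l) (induced_subgraph G ?A)"
        using Suc.IH simple_graph_induced_subgraph[OF G] free_of_induced_subgraph[OF K] by blast
      \<comment> \<open>Here \<open>m\<close> is \<open>k + l\<close>, which is positive even for
        \<open>l = 0\<close> because \<open>k\<close> is.\<close>
      then show ?thesis
        using colourable_Suc_nonneighbours[OF G K, of "k + l" v] \<open>k \<ge> 1\<close> by simp
    qed
  qed
qed

end
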